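(* Let $n\ge 1$ be an integer, let $1\le p_2\le p_1<\infty$, and let $\Psi_1:(0,\infty)\to(0,\infty)$ be a measurable function for which there is a constant $A>0$ such that $\frac{\Psi_1(r)}{r^n}\le A\,\frac{\Psi_1(s)}{s^n}$ for all $0<s\le r$. If $f\in S_{p_1,\Psi_1}$ and, for some measurable function $\Psi_2:(0,\infty)\to(0,\infty)$ and some constant $c>0$, $$\eta_{p_1,\Psi_1}f(r)\le c\,\Psi_1(r)^{1/p_1}\,\Psi_2(r)\quad\text{for every } r>0,$$ then $f\in wL^{p_2,\Psi_2}$.
   Context: Let $B(x,r):=\{y\in\mathbb{R}^n:|x-y|<r\}$ and let $|E|$ denote Lebesgue measure. For $1\le p<\infty$ and a measurable function $\Psi:(0,\infty)\to(0,\infty)$: The generalized weak Morrey space $wL^{p,\Psi}=wL^{p,\Psi}(\mathbb{R}^n)$ is the set of all measurable functions $f$ on $\mathbb{R}^n$ with $$\|f\|_{wL^{p,\Psi}}:=\sup_{a\in\mathbb{R}^n,\,r>0,\,t>0}\frac{t\,|\{x\in B(a,r):|f(x)|>t\}|^{1/p}}{\Psi(r)\,|B(a,r)|^{1/p}}<\infty.$$ The Stummel $p$-modulus of $f\in L^p_{\rm loc}(\mathbb{R}^n)$ is $$\eta_{p,\Psi}f(r):=\sup_{x\in\mathbb{R}^n}\left(\int_{|x-y|<r}\frac{|f(y)|^p\,\Psi(|x-y|)}{|x-y|^n}\,dy\right)^{1/p}\in[0,\infty],\quad r>0,$$ which is nondecreasing in $r$, and the generalized Stummel $p$-class is $S_{p,\Psi}=S_{p,\Psi}(\mathbb{R}^n):=\{f\in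 L^p_{\rm loc}(\mathbb{R}^n):\ \eta_{p,\Psi}f(r)\searrow 0 \text{ as } r\searrow 0\}$, i.e. $\lim_{r\to0^+}\eta_{p,\Psi}f(r)=0$. *)

theory Defs
  imports "HOL-Analysis.Analysis"
begin

text \<open>
  The dimension is \<open>n = CARD('n)\<close> and the measure is Lebesgue measure \<open>lebesgue\<close>. The type class
  \<open>real_normed_field\<close> of values covers real and complex functions. Norms, moduli and
  integrals take values in \<open>ennreal\<close> = $[0,\infty]$. Functions are not identified up to null sets.
  A function on \<open>(0,\<infinity>)\<close> is represented by a function on \<open>real\<close> whose values on
  \<open>{..0}\<close> are irrelevant.
\<close>

definition weight :: "(real \<Rightarrow> real) \<Rightarrow> bool" where
  "weight \<Psi> \<longleftrightarrow>
     \<Psi> \<in> borel_measurable (lebesgue_on {0<..}) \<and> (\<forall>r>0. 0 < \<Psi> r)"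

text \<open>The power $x^a$ on $[0,\infty]$, for \<open>a > 0\<close>.\<close>

definition ennreal_powr :: "ennreal \<Rightarrow> real \<Rightarrow> ennreal" where
  "ennreal_powr x a = (if x = \<infinity> then \<infinity> else ennreal (enn2real x powr a))"

definition weak_morrey_norm ::
    "real \<Rightarrow> (real \<Rightarrow> real) \<Rightarrow> (real ^ 'n \<Rightarrow> 'b::real_normed_field) \<Rightarrow> ennreal" where
  "weak_morrey_norm p \<Psi> f =
     (SUP (a, r, t) \<in> UNIV \<times> {0<..} \<times> {0<..}.
        ennreal (t * measure lebesgue {x \<in> ball a r. norm (f x) > t} powr (1 / p) /
                 (\<Psi> r * measure lebesgue (ball a r) powr (1 / p))))"

definition weak_morrey ::
    "real \<Rightarrow> (real \<Rightarrow> real) \<Rightarrow> (real ^ 'n \<Rightarrow> 'b::real_normed_field) set" where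
  "weak_morrey p \<Psi> = {f \<in> borel_measurable lebesgue. weak_morrey_norm p \<Psi> f < \<infinity>}"

definition Lp_loc :: "real \<Rightarrow> (real ^ 'n \<Rightarrow> 'b::real_normed_field) set" where
  "Lp_loc p =
     {f \<in> borel_measurable lebesgue.
        \<forall>K. compact K \<longrightarrow> (\<integral>\<^sup>+ y \<in> K. ennreal (norm (f y) powr p) \<partial>lebesgue) < \<infinity>}"

text \<open>
  At \<open>y = x\<close> the quotient below is \<open>0\<close> by the convention on division by zero; this affects only a
  null set.
\<close>

definition stummel_modulus ::
    "real \<Rightarrow> (real \<Rightarrow> real) \<Rightarrow> (real ^ 'n \<Rightarrow> 'b::real_normed_field) \<Rightarrow> real \<Rightarrow> ennreal" where
  "stummel_modulus p \<Psi> f r =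
     (SUP x. ennreal_powr
        (\<integral>\<^sup>+ y \<in> ball x r.
           ennreal (norm (f y) powr p * \<Psi> (dist x y) / dist x y ^ CARD('n)) \<partial>lebesgue)
        (1 / p))"

definition stummel_class ::
    "real \<Rightarrow> (real \<Rightarrow> real) \<Rightarrow> (real ^ 'n \<Rightarrow> 'b::real_normed_field) set" where
  "stummel_class p \<Psi> = {f \<in> Lp_loc p. (stummel_modulus p \<Psi> f \<longlongrightarrow> 0) (at_right 0)}"

end

theory Submission
  imports Defs
begin

text \<open>
  On \<open>ball a r\<close> the kernel \<open>\<Psi>1 (dist a y) / dist a y ^ n\<close> is at least \<open>\<Psi>1 r / (A * r ^ n)\<close>, so
  Chebyshev's inequality bounds the density of a superlevel set of \<open>f\<close> in the ball by the Stummel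
  modulus at \<open>r\<close>; there \<open>\<Psi>1 r\<close> cancels against the factor in the hypothesis on the modulus. As a
  density is at most 1, passing from \<open>p1\<close> to the smaller \<open>p2\<close> only decreases its power.
\<close>

text \<open>Removes the outer root from the modulus; an infinite \<open>x\<close> is ruled out
  because its root is infinite too.\<close>

lemma le_powr_of_ennreal_powr_le:
  assumes "p > 0" "K \<ge> 0" "ennreal_powr x (1 / p) \<le> ennreal K"
  shows "x \<le> ennreal (K powr p)"
proof (cases x rule: ennreal_cases)
  case (real u)
  have "u powr (1 / p) \<le> K"
    using assms real by (simp add: ennreal_powr_def)
  then have "(u powr (1 / p)) powr p \<le> K powr p"
    using assms by (intro powr_mono2) auto
  then show ?thesis
    using assms real by (simp add: powr_powr ennreal_leI)
next
  case top
  then show ?thesis using assms by (simp add: ennreal_powr_def top_unique)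
qed

text \<open>Measurability and finiteness guarantee that \<open>measure\<close> on these sets is the
  true volume and not its default value 0.\<close>

lemma lmeasurable_superlevel:
  assumes "f \<in> borel_measurable lebesgue"
  shows "{x \<in> ball a r. norm (f x) > t} \<in> lmeasurable"
proof -
  have "(\<lambda>x. norm (f x)) \<in> borel_measurable lebesgue"
    using assms by (rule measurable_compose) (intro borel_measurable_continuous_onI continuous_intros)
  then have "{x \<in> space lebesgue. norm (f x) > t} \<in> sets lebesgue"
    by measurable
  then have "ball a r \<inter> {x. norm (f x) > t} \<in> lmeasurable"
    by (intro fmeasurable_Int_fmeasurable) auto
  then show ?thesis by (simp add: Int_def)
qed

text \<open>The factor in front of the measure is a lower bound for the Stummel integrand centred at
  \<open>a\<close>, valid almost everywhere on the superlevel set. Integrating it over that set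
  gives the left side.\<close>

lemma superlevel_le_stummel:
  fixes f :: "real ^ 'n \<Rightarrow> 'b::real_normed_field"
  assumes f: "f \<in> borel_measurable lebesgue"
    and "p > 0" "A > 0" "r > 0" "t > 0" "K \<ge> 0"
    and pos: "\<And>s. s > 0 \<Longrightarrow> \<Psi> s > 0"
    and decr: "\<And>s. 0 < s \<Longrightarrow> s \<le> r \<Longrightarrow>
           \<Psi> r / r ^ CARD('n) \<le> A * (\<Psi> s / s ^ CARD('n))"
    and mod: "stummel_modulus p \<Psi> f r \<le> ennreal K"
  shows "t powr p * \<Psi> r / (A * r ^ CARD('n)) * measure lebesgue {x \<in> ball a r. norm (f x) > t}
           \<le> K powr p"
proof -
  define E where "E = {x \<in> ball a r. norm (f x) > t}"
  define k where "k = t powr p * \<Psi> r / (A * r ^ CARD('n))"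
  define g where "g y = norm (f y) powr p * \<Psi> (dist a y) / dist a y ^ CARD('n)" for y
  have E: "E \<in> lmeasurable"
    unfolding E_def using f by (rule lmeasurable_superlevel)
  have k0: "k \<ge> 0"
    unfolding k_def using assms by (intro divide_nonneg_nonneg mult_nonneg_nonneg) (auto intro: less_imp_le)
  \<comment> \<open>The centre must be left out: division by zero makes \<open>g a\<close> equal to
    0, whereas \<open>k\<close> is positive.\<close>
  have gk: "k \<le> g y" if "y \<in> E" "y \<noteq> a" for y
  proof -
    have d: "0 < dist a y" "dist a y \<le> r" and ty: "t \<le> norm (f y)"
      using that by (auto simp: E_def)
    have "k = t powr p * ((\<Psi> r / r ^ CARD('n)) / A)"
      by (simp add: k_def)
    also have "\<dots> \<le> norm (f y) powr p * (\<Psi> (dist a y) / dist a y ^ CARD('n))"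
    proof (rule mult_mono)
      show "t powr p \<le> norm (f y) powr p"
        using ty assms by (intro powr_mono2) auto
      show "\<Psi> r / r ^ CARD('n) / A \<le> \<Psi> (dist a y) / dist a y ^ CARD('n)"
        unfolding pos_divide_le_eq[OF \<open>A > 0\<close>]
        using decr[OF d] by (simp add: mult.commute)
    qed (use assms in \<open>auto intro!: divide_nonneg_nonneg less_imp_le[OF pos]\<close>)
    finally show ?thesis by (simp add: g_def)
  qed
  have "ennreal (k * measure lebesgue E) = ennreal k * emeasure lebesgue E"
    using E k0 by (simp add: ennreal_mult emeasure_eq_measure2 fmeasurableD2)
  also have "\<dots> = (\<integral>\<^sup>+ y \<in> E. ennreal k \<partial>lebesgue)"
    using E by (simp add: nn_integral_cmult_indicator)
  also have "\<dots> \<le> (\<integral>\<^sup>+ y \<in> ball a r. ennreal (g y) \<partial>lebesgue)"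
  proof (rule nn_integral_mono_AE)
    have "AE y in lebesgue. y \<noteq> a"
      by (rule AE_I[of _ _ "{a}"]) auto
    then show "AE y in lebesgue. ennreal k * indicator E y \<le> ennreal (g y) * indicator (ball a r) y"
      by eventually_elim (use gk in \<open>auto simp: indicator_def E_def intro!: ennreal_leI\<close>)
  qed
  \<comment> \<open>The supremum over all centres bounds the integral centred at
    \<open>a\<close>.\<close>
  also have "\<dots> \<le> ennreal (K powr p)"
  proof (rule le_powr_of_ennreal_powr_le)
    show "ennreal_powr (\<integral>\<^sup>+ y \<in> ball a r. ennreal (g y) \<partial>lebesgue) (1 / p) \<le> ennreal K"
      using mod unfolding stummel_modulus_def g_def SUP_le_iff by blast
  qed (use assms in auto)
  finally show ?thesis
    by (simp add: E_def k_def ennreal_le_iff)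
qed

theorem theorem4p9:
  fixes f :: "real ^ 'n \<Rightarrow> 'b::real_normed_field"
    and p1 p2 A c :: real
    and \<Psi>1 \<Psi>2 :: "real \<Rightarrow> real"
  assumes "1 \<le> p2" and "p2 \<le> p1"
    and "weight \<Psi>1"
    and "A > 0"
    and "\<And>r s. 0 < s \<Longrightarrow> s \<le> r \<Longrightarrow>
           \<Psi>1 r / r ^ CARD('n) \<le> A * (\<Psi>1 s / s ^ CARD('n))"
    and "f \<in> stummel_class p1 \<Psi>1"
    and "weight \<Psi>2"
    and "c > 0"
    and "\<And>r. r > 0 \<Longrightarrow>
           stummel_modulus p1 \<Psi>1 f r \<le> ennreal (c * \<Psi>1 r powr (1 / p1) * \<Psi>2 r)"
  shows "f \<in> weak_morrey p2 \<Psi>2"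
proof -
  have f: "f \<in> borel_measurable lebesgue"
    using assms(6) by (simp add: stummel_class_def Lp_loc_def)
  have pos1: "\<Psi>1 s > 0" and pos2: "\<Psi>2 s > 0" if "s > 0" for s
    using assms(3,7) that by (auto simp: weight_def)
  define v where "v = unit_ball_vol (real CARD('n))"
  have v: "v > 0" by (simp add: v_def)
  \<comment> \<open>\<open>C\<close> is what remains once \<open>\<Psi>1 r\<close> and
    \<open>r ^ CARD('n)\<close> have cancelled and the \<open>p1\<close>-th root is taken, so it is
    independent of \<open>a\<close>, \<open>r\<close> and \<open>t\<close>.\<close>
  define C where "C = (A * c powr p1 / v) powr (1 / p1)"
  have root: "(x powr p1 * u) powr (1 / p1) = x * u powr (1 / p1)" if "x > 0" "u \<ge> 0" for x u
    using that assms(1,2) by (simp add: powr_mult powr_powr)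
  have bound: "t * measure lebesgue {x \<in> ball a r. norm (f x) > t} powr (1 / p2) /
      (\<Psi>2 r * measure lebesgue (ball a r) powr (1 / p2)) \<le> C"
    if r: "r > 0" and t: "t > 0" for a r t
  proof -
    define m where "m = measure lebesgue {x \<in> ball a r. norm (f x) > t}"
    define b where "b = measure lebesgue (ball a r)"
    have b: "b = v * r ^ CARD('n)"
      using r by (simp add: b_def v_def content_ball)
    have b0: "b > 0" using b v r by simp
    have m0: "m \<ge> 0" by (simp add: m_def)
    have "m \<le> b"
      unfolding m_def b_def
      by (intro measure_mono_fmeasurable fmeasurableD lmeasurable_superlevel f) auto
    then have q: "0 \<le> m / b" "m / b \<le> 1" using m0 b0 by auto
    have "t powr p1 * \<Psi>1 r / (A * r ^ CARD('n)) * m \<le> (c * \<Psi>1 r powr (1 / p1) * \<Psi>2 r) powr p1"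
      unfolding m_def
      by (rule superlevel_le_stummel)
        (use f assms r t pos1 pos2[OF r] in \<open>auto intro!: mult_nonneg_nonneg\<close>)
    also have "\<dots> = c powr p1 * \<Psi>1 r * \<Psi>2 r powr p1"
      using assms pos1[OF r] pos2[OF r] by (simp add: powr_mult powr_powr)
    finally have "\<Psi>1 r * (t powr p1 * m) \<le> \<Psi>1 r * (A * c powr p1 * r ^ CARD('n) * \<Psi>2 r powr p1)"
      using \<open>A > 0\<close> r by (simp add: field_simps)
    then have "t powr p1 * m \<le> A * c powr p1 * r ^ CARD('n) * \<Psi>2 r powr p1"
      using pos1[OF r] by simp
    \<comment> \<open>Dividing by the volume \<open>b\<close> trades \<open>r ^ CARD('n)\<close> for
      the constant \<open>1 / v\<close>.\<close>
    then have "t powr p1 * (m / b) \<le> A * c powr p1 / v * \<Psi>2 r powr p1"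
      using v r by (simp add: b field_simps)
    then have "(t powr p1 * (m / b)) powr (1 / p1) \<le> (A * c powr p1 / v * \<Psi>2 r powr p1) powr (1 / p1)"
      using assms(1,2) q(1) m0 b0 by (intro powr_mono2) auto
    then have *: "t * (m / b) powr (1 / p1) \<le> C * \<Psi>2 r"
      using root[of t "m / b"] root[of "\<Psi>2 r" "A * c powr p1 / v"] assms(4) v q(1) t pos2[OF r]
      unfolding C_def by (simp add: mult.commute)
    \<comment> \<open>On [0,1] a larger exponent gives a smaller power, and
      \<open>1 / p1 \<le> 1 / p2\<close>.\<close>
    have "(m / b) powr (1 / p2) \<le> (m / b) powr (1 / p1)"
      using q assms(1,2) by (intro powr_mono') (auto simp: frac_le)
    then have "t * (m / b) powr (1 / p2) \<le> C * \<Psi>2 r"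
      using * t by (meson mult_left_mono less_imp_le order_trans)
    \<comment> \<open>The power of the density splits into the quotient of powers in the weak Morrey
      norm.\<close>
    then show ?thesis
      unfolding m_def[symmetric] b_def[symmetric]
      using m0 b0 pos2[OF r] by (simp add: powr_divide field_simps)
  qed
  have "weak_morrey_norm p2 \<Psi>2 f \<le> ennreal C"
    unfolding weak_morrey_norm_def
    by (rule SUP_least, clarify, intro ennreal_leI bound) simp_all
  then have "weak_morrey_norm p2 \<Psi>2 f < \<infinity>"
    by (rule le_less_trans) simp
  with f show ?thesis by (simp add: weak_morrey_def)
qed

end
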